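(* Let $\chi$ be a primitive odd Dirichlet character modulo $N$. For $\hbar>0$ put $$f_{\xi_{\chi,N}}(\hbar)=\sum_{k\in(\mathbb Z/N\mathbb Z)^\times}\chi(k)\log\bigl((e^{-\hbar}\zeta_N^k;e^{-2\hbar})_\infty\bigr),\qquad L_{\xi_{\chi,N}}(s)=\frac1{\Gamma(s)}\int_0^\infty f_{\xi_{\chi,N}}(\hbar)\,\hbar^{s-1}\,d\hbar.$$ Then for $\Re(s)>1$, $$L_{\xi_{\chi,N}}(s)=-G(\chi)\,(1-2^{-s})\,\zeta(s)\,L(s+1,\chi^{-1}).$$
   Context: $\zeta_N=e^{2\pi i/N}$, $(a;q)_\infty=\prod_{r\ge0}(1-aq^r)$, and the logarithm of a Pochhammer symbol is the sum over factors of the power-series branch $\log(1-u)=-\sum_{r\ge1}u^r/r$, $|u|<1$. The Gauss sum is $G(\chi)=\sum_{a\in(\mathbb Z/N\mathbb Z)^\times}\chi(a)\zeta_N^a$. "Odd" means $\chi(-1)=-1$; $\chi^{-1}$ is the inverse (complex conjugate) character, extended by zero to integers not prime to $N$; $\zeta(s)$ and $L(s,\cdot)$ are the Riemann zeta and Dirichlet $L$-functions. ($\xi_{\chi,N}=\sum_{a\in(\mathbb Z/N)^\times}\chi(a)[\zeta_N^a]_{\mathrm{cyc}}$ is the formal character packet labelling these functions.) *)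

theory Defs
  imports "HOL-Analysis.Analysis" "HOL-Number_Theory.Totient"
begin

definition dirichlet_character :: "nat \<Rightarrow> (int \<Rightarrow> complex) \<Rightarrow> bool" where
  "dirichlet_character N chi \<longleftrightarrow>
     N > 0 \<and> chi 1 = 1 \<and>
     (\<forall>a b. chi (a * b) = chi a * chi b) \<and>
     (\<forall>a. chi (a + int N) = chi a) \<and>
     (\<forall>a. chi a = 0 \<longleftrightarrow> \<not> coprime a (int N))"

text \<open>Primitive: not induced by a character modulo a proper divisor of the modulus.\<close>

definition primitive_dirichlet_character :: "nat \<Rightarrow> (int \<Rightarrow> complex) \<Rightarrow> bool" where
  "primitive_dirichlet_character N chi \<longleftrightarrow>
     dirichlet_character N chi \<and>
     \<not> (\<exists>d psi. d dvd N \<and> d < N \<and> dirichlet_character d psi \<and>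
              (\<forall>a. coprime a (int N) \<longrightarrow> chi a = psi a))"

definition odd_character :: "(int \<Rightarrow> complex) \<Rightarrow> bool" where
  "odd_character chi \<longleftrightarrow> chi (-1) = -1"

text \<open>Since \<open>inverse 0 = 0\<close>, this is again zero at the integers not prime to the modulus.\<close>

definition inv_character :: "(int \<Rightarrow> complex) \<Rightarrow> int \<Rightarrow> complex" where
  "inv_character chi = (\<lambda>a. inverse (chi a))"

definition root_of_unity :: "nat \<Rightarrow> complex" where
  "root_of_unity N = exp (2 * of_real pi * \<i> / of_nat N)"

text \<open>Sums over \<open>(\<int>/N\<int>)\<^sup>\<times>\<close> run over the representatives \<^term>\<open>totatives N\<close>.\<close>

definition gauss_sum :: "nat \<Rightarrow> (int \<Rightarrow> complex) \<Rightarrow> complex" where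
  "gauss_sum N chi = (\<Sum>a\<in>totatives N. chi (int a) * root_of_unity N ^ a)"

text \<open>
  The functions \<open>\<zeta>\<close> and \<open>L\<close> are given by their Dirichlet series, which represent them
  only for real part greater than 1.
\<close>

definition riemann_zeta :: "complex \<Rightarrow> complex" where
  "riemann_zeta s = (\<Sum>n. 1 / of_nat (Suc n) powr s)"

definition dirichlet_L :: "(int \<Rightarrow> complex) \<Rightarrow> complex \<Rightarrow> complex" where
  "dirichlet_L chi s = (\<Sum>n. chi (int (Suc n)) / of_nat (Suc n) powr s)"

text \<open>The power-series branch of \<open>log (1 - u)\<close>, for \<open>norm u < 1\<close>.\<close>

definition log_one_minus :: "complex \<Rightarrow> complex" where
  "log_one_minus u = - (\<Sum>r. u ^ Suc r / of_nat (Suc r))"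

definition qpochhammer_inf :: "complex \<Rightarrow> complex \<Rightarrow> complex" where
  "qpochhammer_inf a q = (\<Prod>r. 1 - a * q ^ r)"

text \<open>
  The logarithm of \<^term>\<open>qpochhammer_inf a q\<close>, for \<open>norm a < 1\<close> and \<open>norm q < 1\<close>, taken
  factor by factor. It need not be the principal branch at the product.
\<close>

definition log_qpochhammer_inf :: "complex \<Rightarrow> complex \<Rightarrow> complex" where
  "log_qpochhammer_inf a q = (\<Sum>r. log_one_minus (a * q ^ r))"

lemma log_one_minus_eq_Ln:
  assumes "norm u < 1"
  shows "log_one_minus u = Ln (1 - u)"
proof -
  have "(\<lambda>n. (-1) ^ Suc n / of_nat n * (-u) ^ n) sums Ln (1 + - u)"
    by (rule Ln_series) (use assms in simp)
  moreover have "(\<lambda>n. (-1) ^ Suc n / of_nat n * (-u) ^ n) = (\<lambda>n. - (u ^ n / of_nat n))"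
    by (auto simp: fun_eq_iff power_minus[of u] field_simps simp flip: power_add)
  ultimately have "(\<lambda>n. - (u ^ n / of_nat n)) sums Ln (1 - u)"
    by simp
  from sums_minus[OF this] have "(\<lambda>n. u ^ n / of_nat n) sums (- Ln (1 - u))"
    by simp
  then have "(\<lambda>n. u ^ Suc n / of_nat (Suc n)) sums (- Ln (1 - u))"
    by (subst sums_Suc_iff) simp
  then show ?thesis
    by (simp add: log_one_minus_def sums_iff)
qed

lemma exp_log_qpochhammer_inf:
  assumes "norm a < 1" "norm q < 1"
  shows "summable (\<lambda>r. log_one_minus (a * q ^ r))"
    and "exp (log_qpochhammer_inf a q) = qpochhammer_inf a q"
proof -
  have lt: "norm (a * q ^ r) < 1" for r
  proof -
    have "norm (a * q ^ r) \<le> norm a * 1"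
      unfolding norm_mult norm_power
      by (intro mult_left_mono power_le_one) (use assms in auto)
    then show ?thesis using assms by simp
  qed
  have nz: "1 - a * q ^ r \<noteq> 0" for r
    using lt[of r] by auto
  have log: "log_one_minus (a * q ^ r) = Ln (1 - a * q ^ r)" for r
    using log_one_minus_eq_Ln[OF lt] .
  have "summable (\<lambda>r. norm a * norm q ^ r)"
    by (intro summable_mult summable_geometric) (use assms in simp)
  then have sum: "summable (\<lambda>r. norm (- (a * q ^ r)))"
    by (simp add: norm_mult norm_power)
  have "- (a * q ^ r) \<noteq> -1" for r
    using nz[of r] by simp
  from summable_imp_convergent_prod_complex[OF sum this]
  have "convergent_prod (\<lambda>r. 1 - a * q ^ r)"
    by simp
  then show 1: "summable (\<lambda>r. log_one_minus (a * q ^ r))"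
    unfolding log by (rule summable_Ln_complex) (rule nz)
  have "exp (log_one_minus (a * q ^ r)) = 1 - a * q ^ r" for r
    using nz[of r] by (simp add: log)
  then show "exp (log_qpochhammer_inf a q) = qpochhammer_inf a q"
    using prodinf_exp[OF 1] by (simp add: log_qpochhammer_inf_def qpochhammer_inf_def)
qed

definition packet_fun :: "nat \<Rightarrow> (int \<Rightarrow> complex) \<Rightarrow> real \<Rightarrow> complex" where
  "packet_fun N chi h =
     (\<Sum>k\<in>totatives N. chi (int k) *
        log_qpochhammer_inf (exp (- of_real h) * root_of_unity N ^ k) (exp (- 2 * of_real h)))"

definition packet_integrand :: "nat \<Rightarrow> (int \<Rightarrow> complex) \<Rightarrow> complex \<Rightarrow> real \<Rightarrow> complex" where
  "packet_integrand N chi s h = packet_fun N chi h * of_real h powr (s - 1)"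

definition packet_L :: "nat \<Rightarrow> (int \<Rightarrow> complex) \<Rightarrow> complex \<Rightarrow> complex" where
  "packet_L N chi s = 1 / Gamma s * (LINT h:{0<..}|lborel. packet_integrand N chi s h)"

end

theory Submission
  imports Defs
begin

text \<open>
  Expanding the logarithm factor by factor turns \<open>packet_fun N chi h\<close> into a sum over \<open>k\<close>, \<open>m\<close> and
  \<open>n \<ge> 1\<close> of \<open>- chi k * \<zeta>\<^sub>N ^ (k * n) * exp (- (2 * m + 1) * n * h) / n\<close>. Since \<open>chi\<close> is primitive,
  the sum over \<open>k\<close> is \<open>inv_character chi n * gauss_sum N chi\<close> for every \<open>n\<close>, including those not prime
  to \<open>N\<close>, where it vanishes (\<open>gauss_sum_separable\<close>). What remains is an exponential series in \<open>h\<close> with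
  exponents \<open>(2 * m + 1) * n\<close> (\<open>packet_fun_expansion\<close>). Its Mellin transform, computed term by term with
  Euler's integral (\<open>mellin_transform_exp_series\<close>), is \<open>\<Gamma>(s)\<close> times the double Dirichlet series

    \<open>- gauss_sum N chi * (\<Sum>m n. inv_character chi n / (n * ((2 * m + 1) * n) powr s))\<close>,

  which factors into a sum over \<open>m\<close> and a sum over \<open>n\<close>. The sum over the odd numbers \<open>2 * m + 1\<close> is zeta
  with its Euler factor at \<open>2\<close> removed (\<open>odd_zeta_series\<close>), and the sum over \<open>n\<close> is the \<open>L\<close>-series at
  \<open>s + 1\<close>.

  For \<open>Re s > 1\<close> the double series converges absolutely. That makes the integrand integrable and
  permits both the interchange of sum and integral and the factorisation.
\<close>

section \<open>Gauss sums of primitive characters\<close>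

lemma dirichlet_character_cong:
  assumes "dirichlet_character N chi" "[a = b] (mod int N)"
  shows "chi a = chi b"
proof -
  have period: "chi (x + int N) = chi x" for x
    using assms(1) by (simp add: dirichlet_character_def)
  have "chi (x + int n * int N) = chi x" for x n
  proof (induction n)
    case (Suc n)
    have "x + int (Suc n) * int N = (x + int n * int N) + int N"
      by (simp add: algebra_simps)
    with Suc period show ?case by metis
  qed simp
  moreover obtain k where "b = a + k * int N"
    using assms(2) by (metis cong_iff_lin mult.commute)
  moreover have "k = int (nat k) \<or> k = - int (nat (-k))" by arith
  ultimately show ?thesis
    by (metis add.commute add_minus_cancel mult_minus_left)
qed

text \<open>
  A bound by the sum over one period is crude (the nonzero values are roots of unity), but boundedness is
  all that convergence of the \<open>L\<close>-series to the right of \<open>1\<close> asks for.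
\<close>
lemma dirichlet_character_inverse_bounded:
  assumes "dirichlet_character N chi"
  obtains B where "\<And>a. norm (inverse (chi a)) \<le> B"
proof
  fix a
  have N: "N > 0" using assms by (simp add: dirichlet_character_def)
  have "chi a = chi (int (nat (a mod int N)))"
    using N by (intro dirichlet_character_cong[OF assms]) (simp add: cong_def)
  moreover have "nat (a mod int N) \<in> {..<N}"
    using N by (simp add: nat_less_iff)
  ultimately show "norm (inverse (chi a)) \<le> (\<Sum>k<N. norm (inverse (chi (int k))))"
    using member_le_sum[of "nat (a mod int N)" "{..<N}" "\<lambda>k. norm (inverse (chi (int k)))"]
    by simp
qed

text \<open>
  Surjectivity of \<open>(\<int>/n\<int>)\<^sup>\<times> \<rightarrow> (\<int>/d\<int>)\<^sup>\<times>\<close>. A prime factor \<open>p\<close> of \<open>n\<close> must not divide \<open>a + d * t\<close>.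
  With \<open>t\<close> the product of the prime factors of \<open>n\<close> that do not divide \<open>a\<close>, exactly one of the two
  summands is divisible by \<open>p\<close>: if \<open>p\<close> divides \<open>a\<close>, then it divides neither \<open>d\<close> (by coprimality)
  nor \<open>t\<close>; if it does not divide \<open>a\<close>, then it divides \<open>t\<close>.
\<close>
lemma coprime_residue_lift:
  fixes a d n :: int
  assumes "coprime a d" "d dvd n" "n \<noteq> 0"
  obtains b where "coprime b n" "[b = a] (mod d)"
proof
  define P where "P = {p. prime p \<and> p dvd n \<and> \<not> p dvd a}"
  define t where "t = \<Prod>P"
  have fin: "finite P"
    unfolding P_def using finite_divisors_int[OF assms(3)] by (rule rev_finite_subset) (auto dest: dvd_imp_le_int)
  show "[a + d * t = a] (mod d)"
    by (simp add: cong_iff_dvd_diff)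
  show "coprime (a + d * t) n"
  proof (rule ccontr)
    assume "\<not> coprime (a + d * t) n"
    then have "gcd (a + d * t) n \<noteq> 0" "\<not> is_unit (gcd (a + d * t) n)"
      using assms(3) by auto
    then obtain p where "prime p" "p dvd gcd (a + d * t) n"
      by (rule prime_divisorE)
    then have p: "prime p" "p dvd a + d * t" "p dvd n" by auto
    show False
    proof (cases "p dvd a")
      case True
      then have "\<not> p dvd d"
        using assms(1) p(1) by (meson coprime_common_divisor not_prime_unit)
      with True have "p dvd t"
        using p by (simp add: dvd_add_right_iff prime_dvd_mult_iff)
      then obtain q where "q \<in> P" "p dvd q"
        using p(1) fin unfolding t_def by (metis (no_types, lifting) prime_dvd_prod_iff)
      with True p(1) show False unfolding P_def
        by (metis (no_types, lifting) mem_Collect_eq primes_dvd_imp_eq)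
    next
      case False
      then have "p dvd t" using p fin unfolding t_def P_def
        by (intro dvd_prodI) auto
      with False p show False by (simp add: dvd_add_left_iff)
    qed
  qed
qed

text \<open>
  The form in which primitivity enters. If \<open>chi\<close> were trivial on the kernel of reduction modulo
  \<open>d\<close>, it would be constant on the fibres of \<open>(\<int>/N\<int>)\<^sup>\<times> \<rightarrow> (\<int>/d\<int>)\<^sup>\<times>\<close>, and transporting it along lifts
  would give a character modulo \<open>d\<close> that induces it.
\<close>
lemma primitive_character_nontrivial_mod_divisor:
  assumes prim: "primitive_dirichlet_character N chi" and d: "d dvd N" "d < N"
  obtains a where "coprime a (int N)" "[a = 1] (mod int d)" "chi a \<noteq> 1"
proof (rule ccontr)
  assume "\<not> thesis"
  with that have triv: "chi a = 1" if "coprime a (int N)" "[a = 1] (mod int d)" for a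
    using \<open>coprime a (int N)\<close> \<open>[a = 1] (mod int d)\<close> by blast
  have chi: "dirichlet_character N chi"
    using prim by (simp add: primitive_dirichlet_character_def)
  then have N: "N > 0" and mult: "\<And>a b. chi (a * b) = chi a * chi b" and one: "chi 1 = 1"
    and zero: "\<And>a. chi a = 0 \<longleftrightarrow> \<not> coprime a (int N)"
    by (auto simp: dirichlet_character_def)
  have d0: "d > 0" using d N by (auto intro: Nat.gr0I)
  have dN: "int d dvd int N" using d by simp
  have same: "chi a = chi b"
    if "coprime a (int N)" "coprime b (int N)" "[a = b] (mod int d)" for a b
  proof -
    obtain b' where b': "[b * b' = 1] (mod int N)"
      using \<open>coprime b (int N)\<close> cong_solve_coprime_int by blast
    have "coprime b' (int N)"
      using b' by (metis coprime_1_left coprime_mult_left_iff cong_imp_coprime cong_sym)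
    moreover have "[a * b' = 1] (mod int d)"
      using that(3) b' dN by (meson cong_dvd_modulus cong_scalar_right cong_trans)
    ultimately have "chi (a * b') = 1" "chi (b * b') = 1"
      using triv[of "a * b'"] that(1) dirichlet_character_cong[OF chi b'] one by auto
    then show ?thesis
      by (metis mult mult_cancel_right zero_neq_one mult_zero_right)
  qed
  define lift where "lift a = (SOME b. coprime b (int N) \<and> [b = a] (mod int d))" for a
  have lift: "coprime (lift a) (int N)" "[lift a = a] (mod int d)" if "coprime a (int d)" for a
  proof -
    have "\<exists>b. coprime b (int N) \<and> [b = a] (mod int d)"
      using coprime_residue_lift[OF that dN] N by (metis of_nat_0_less_iff less_irrefl)
    from someI_ex[OF this] show "coprime (lift a) (int N)" "[lift a = a] (mod int d)"
      by (auto simp: lift_def)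
  qed
  define psi where "psi a = (if coprime a (int d) then chi (lift a) else 0)" for a
  have psi: "psi a = chi b" if "coprime b (int N)" "[b = a] (mod int d)" for a b
  proof -
    have "coprime a (int d)"
      using that dN by (meson cong_imp_coprime coprime_divisors dvd_refl)
    then show ?thesis
      unfolding psi_def using lift[of a] that by (auto intro!: same intro: cong_trans cong_sym)
  qed
  have "dirichlet_character d psi"
    unfolding dirichlet_character_def
  proof (intro conjI allI)
    show "d > 0" by fact
    show "psi 1 = 1" using psi[of 1 1] one by simp
    show "psi (a * b) = psi a * psi b" for a b
    proof (cases "coprime a (int d) \<and> coprime b (int d)")
      case True
      then have "psi (a * b) = chi (lift a * lift b)"
        using lift[of a] lift[of b] by (intro psi) (auto intro: cong_mult)
      with True show ?thesis by (simp add: mult psi_def)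
    qed (auto simp: psi_def)
    show "psi (a + int d) = psi a" for a
    proof (cases "coprime a (int d)")
      case True
      then have "psi (a + int d) = chi (lift a)"
        using lift[of a] by (intro psi) (auto simp: cong_def)
      with True show ?thesis by (simp add: psi_def)
    next
      case False
      then have "\<not> coprime (a + int d) (int d)"
        unfolding coprime_iff_gcd_eq_1 gcd_add1 .
      with False show ?thesis by (simp add: psi_def)
    qed
    show "psi a = 0 \<longleftrightarrow> \<not> coprime a (int d)" for a
      using lift[of a] zero[of "lift a"] by (auto simp: psi_def)
  qed
  moreover have "\<forall>a. coprime a (int N) \<longrightarrow> chi a = psi a"
    using psi by (metis cong_refl)
  ultimately show False
    using prim d unfolding primitive_dirichlet_character_def by blast
qed

lemma root_of_unity_power_cong:
  assumes "N > 0" "[a = b] (mod N)"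
  shows "root_of_unity N ^ a = root_of_unity N ^ b"
proof -
  have one: "root_of_unity N ^ N = 1"
  proof -
    have "root_of_unity N ^ N = exp (of_nat N * (2 * of_real pi * \<i> / of_nat N))"
      by (simp only: root_of_unity_def exp_of_nat_mult)
    also have "\<dots> = 1" using assms by (simp add: exp_two_pi_i')
    finally show ?thesis .
  qed
  have red: "root_of_unity N ^ c = root_of_unity N ^ (c mod N)" for c
  proof -
    have "root_of_unity N ^ c = root_of_unity N ^ (N * (c div N) + c mod N)" by simp
    also have "\<dots> = root_of_unity N ^ (c mod N)" by (simp only: power_add power_mult one) simp
    finally show ?thesis .
  qed
  from assms(2) have "a mod N = b mod N" by (simp add: cong_def)
  with red[of a] red[of b] show ?thesis by simp
qed

text \<open>
  Multiplication by \<open>a\<close> permutes the units modulo \<open>N\<close>. Both cases of the separability of the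
  twisted Gauss sum \<open>S r\<close>, for \<open>r\<close> prime to \<open>N\<close> and for \<open>r\<close> not prime to \<open>N\<close>, are instances of the
  resulting identity \<open>chi a * S (a * r) = S r\<close>.
\<close>
lemma gauss_sum_shift:
  fixes a r N :: nat
  assumes chi: "dirichlet_character N chi" and a: "coprime a N"
  shows "chi (int a) * (\<Sum>k\<in>totatives N. chi (int k) * root_of_unity N ^ (k * (a * r))) =
         (\<Sum>k\<in>totatives N. chi (int k) * root_of_unity N ^ (k * r))"
proof -
  have N: "N > 0" and mult: "\<And>a b. chi (a * b) = chi a * chi b"
    using chi by (auto simp: dirichlet_character_def)
  \<comment> \<open>The representatives lie in \<open>{1..N}\<close>, so for \<open>N = 1\<close> the only unit is \<open>1\<close>, whereas \<open>(a * k) mod 1 = 0\<close>.\<close>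
  define f where "f k = (if N = 1 then 1 else (a * k) mod N)" for k
  have f_cong: "[f k = a * k] (mod N)" for k
    by (auto simp: f_def cong_def)
  have f_tot: "f k \<in> totatives N" if "k \<in> totatives N" for k
  proof (cases "N = 1")
    case False
    have "coprime (a * k) N" using that a by (simp add: in_totatives_iff)
    then have c: "coprime (a * k mod N) N" using N by simp
    then have "a * k mod N \<noteq> 0" using False by (intro notI) simp
    with c N False show ?thesis by (simp add: f_def in_totatives_iff less_imp_le)
  qed (simp add: f_def)
  have inj: "inj_on f (totatives N)"
  proof (rule inj_onI)
    fix k l assume kl: "k \<in> totatives N" "l \<in> totatives N" "f k = f l"
    then have "[a * k = a * l] (mod N)" using f_cong by (metis cong_sym cong_trans)
    then have "[k = l] (mod N)" using a by (simp add: cong_mult_lcancel_nat)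
    then show "k = l"
      using kl totatives_less[of k N] totatives_less[of l N] N
      by (cases "N = 1") (auto simp: cong_def)
  qed
  have bij: "bij_betw f (totatives N) (totatives N)"
    unfolding bij_betw_def using inj f_tot by (auto simp: endo_inj_surj image_subset_iff)
  have "(\<Sum>k\<in>totatives N. chi (int k) * root_of_unity N ^ (k * r)) =
        (\<Sum>k\<in>totatives N. chi (int (f k)) * root_of_unity N ^ (f k * r))"
    by (rule sum.reindex_bij_betw[OF bij, symmetric])
  also have "\<dots> = (\<Sum>k\<in>totatives N. chi (int a) * (chi (int k) * root_of_unity N ^ (k * (a * r))))"
  proof (rule sum.cong[OF refl])
    fix k
    have "chi (int (f k)) = chi (int a * int k)"
      using f_cong[of k] by (intro dirichlet_character_cong[OF chi]) (simp flip: cong_int_iff)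
    moreover have "[f k * r = k * (a * r)] (mod N)"
      using cong_scalar_right[OF f_cong[of k], of r] by (simp add: mult_ac)
    ultimately show "chi (int (f k)) * root_of_unity N ^ (f k * r) =
        chi (int a) * (chi (int k) * root_of_unity N ^ (k * (a * r)))"
      using root_of_unity_power_cong[OF N] mult by (metis mult.assoc)
  qed
  finally show ?thesis by (simp add: sum_distrib_left)
qed

text \<open>
  For \<open>r\<close> prime to \<open>N\<close> this is the shift identity for the pair \<open>(r, 1)\<close>. Otherwise let \<open>g > 1\<close> be the
  greatest common divisor of \<open>r\<close> and \<open>N\<close>. Primitivity gives a unit \<open>a\<close> with \<open>chi a \<noteq> 1\<close> that is \<open>1\<close> modulo
  \<open>N / g\<close>; then \<open>a * r\<close> and \<open>r\<close> agree modulo \<open>N\<close>, and the shift identity reads \<open>chi a * S r = S r\<close>,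
  so both sides vanish.
\<close>
lemma gauss_sum_separable:
  assumes prim: "primitive_dirichlet_character N chi"
  shows "(\<Sum>k\<in>totatives N. chi (int k) * root_of_unity N ^ (k * r)) =
         inv_character chi (int r) * gauss_sum N chi"
    (is "?S r = _")
proof (cases "coprime r N")
  case True
  have chi: "dirichlet_character N chi"
    using prim by (simp add: primitive_dirichlet_character_def)
  have "chi (int r) * ?S r = gauss_sum N chi"
    using gauss_sum_shift[OF chi True, of 1] by (simp add: gauss_sum_def)
  moreover have "chi (int r) \<noteq> 0" using True chi by (simp add: dirichlet_character_def)
  ultimately show ?thesis by (simp add: inv_character_def field_simps)
next
  case False
  have chi: "dirichlet_character N chi" and N: "N > 0"
    using prim by (auto simp: primitive_dirichlet_character_def dirichlet_character_def)
  define g where "g = gcd r N"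
  define d where "d = N div g"
  have g: "g dvd N" "g dvd r" by (simp_all add: g_def)
  have "g > 1" using False N by (metis g_def coprime_iff_gcd_eq_1 gcd_pos_nat nat_neq_iff less_one not_gr_zero)
  then have "d dvd N" "d < N" using g N by (auto simp: d_def)
  with prim obtain b where b: "coprime b (int N)" "[b = 1] (mod int d)" "chi b \<noteq> 1"
    by (rule primitive_character_nontrivial_mod_divisor)
  define a where "a = nat (b mod int N)"
  have ab: "[int a = b] (mod int N)" using N by (simp add: a_def cong_def)
  then have a1: "[int a = 1] (mod int d)"
    using b(2) \<open>d dvd N\<close> by (meson cong_dvd_modulus cong_trans int_dvd_int_iff)
  have a: "coprime a N"
    using b(1) ab by (metis cong_imp_coprime cong_sym coprime_int_iff)
  have "chi (int a) \<noteq> 1" using b(3) dirichlet_character_cong[OF chi ab] by simp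
  have "int N dvd (int a - 1) * int r"
  proof -
    have "int d dvd int a - 1" using a1 by (simp add: cong_iff_dvd_diff)
    then have "int d * int g dvd (int a - 1) * int r"
      using g by (intro mult_dvd_mono) auto
    then show ?thesis using g by (simp add: d_def flip: of_nat_mult)
  qed
  then have "[int (a * r) = int r] (mod int N)" by (simp add: cong_iff_dvd_diff algebra_simps)
  then have ar: "[a * r = r] (mod N)" using cong_int_iff by blast
  have "?S (a * r) = ?S r"
    by (intro sum.cong refl arg_cong2[where f = "(*)"] root_of_unity_power_cong N cong_scalar_left ar)
  with gauss_sum_shift[OF chi a, of r] have "chi (int a) * ?S r = ?S r" by simp
  then have "?S r = 0" using \<open>chi (int a) \<noteq> 1\<close> by simp
  moreover have "chi (int r) = 0" using False chi by (simp add: dirichlet_character_def)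
  ultimately show ?thesis by (simp add: inv_character_def)
qed

section \<open>Absolutely convergent double series\<close>

lemma has_sum_finite_sum:
  fixes f :: "'i \<Rightarrow> 'a \<Rightarrow> 'b :: topological_comm_monoid_add"
  assumes "\<And>i. i \<in> I \<Longrightarrow> (f i has_sum S i) A"
  shows "((\<lambda>x. \<Sum>i\<in>I. f i x) has_sum (\<Sum>i\<in>I. S i)) A"
  using assms by (induction I rule: infinite_finite_induct) (auto intro: has_sum_add)

lemma has_sum_mult_Times:
  fixes f g :: "nat \<Rightarrow> 'a :: {real_normed_field, banach}"
  assumes f: "summable (\<lambda>m. norm (f m))" and g: "summable (\<lambda>r. norm (g r))"
  shows "(\<lambda>p. norm (case p of (m, r) \<Rightarrow> f m * g r)) summable_on UNIV"
    and "((\<lambda>(m, r). f m * g r) has_sum (suminf f * suminf g)) UNIV"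
proof -
  have inner: "((\<lambda>r. f m * g r) has_sum (f m * suminf g)) UNIV" for m
    by (intro has_sum_cmult_right norm_summable_imp_has_sum g summable_sums summable_norm_cancel[OF g])
  have outer: "((\<lambda>m. f m * suminf g) has_sum (suminf f * suminf g)) UNIV"
    by (intro has_sum_cmult_left norm_summable_imp_has_sum f summable_sums summable_norm_cancel[OF f])
  have ninner: "((\<lambda>r. norm (f m) * norm (g r)) has_sum (norm (f m) * (\<Sum>r. norm (g r)))) UNIV" for m
    by (intro has_sum_cmult_right sums_nonneg_imp_has_sum summable_sums g) simp
  have nouter: "(\<lambda>m. norm (f m) * (\<Sum>r. norm (g r))) summable_on UNIV"
    by (intro summable_on_cmult_left summable_nonneg_imp_summable_on f) simp
  have "(\<lambda>p. norm (f (fst p)) * norm (g (snd p))) summable_on (Sigma UNIV (\<lambda>_. UNIV))"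
    by (rule summable_on_SigmaI[OF _ nouter]) (use ninner in auto)
  then show *: "(\<lambda>p. norm (case p of (m, r) \<Rightarrow> f m * g r)) summable_on UNIV"
    by (simp add: case_prod_unfold norm_mult)
  have "((\<lambda>(m, r). f m * g r) has_sum (suminf f * suminf g)) (Sigma UNIV (\<lambda>_. UNIV))"
    by (rule has_sum_SigmaI[where g = "\<lambda>m. f m * suminf g"])
       (use inner outer abs_summable_summable[OF *] in auto)
  then show "((\<lambda>(m, r). f m * g r) has_sum (suminf f * suminf g)) UNIV" by simp
qed

text \<open>
  The iterated series that defines the logarithm is an absolutely convergent double series: its
  term of index \<open>(m, r)\<close> is dominated by \<open>norm q ^ m * norm a ^ r\<close>. This is what allows the pairs
  \<open>(m, r)\<close> to be enumerated in any order when the series is integrated term by term.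
\<close>
lemma has_sum_log_qpochhammer_inf:
  assumes a: "norm a < 1" and q: "norm q < 1"
  shows "((\<lambda>(m, r). - ((a * q ^ m) ^ Suc r / of_nat (Suc r))) has_sum log_qpochhammer_inf a q) UNIV"
proof -
  let ?F = "\<lambda>(m, r). - ((a * q ^ m) ^ Suc r / of_nat (Suc r)) :: complex"
  have geo: "summable (\<lambda>m. norm (x ^ m))" if "norm x < 1" for x :: complex
    using that by (simp add: norm_power summable_geometric)
  have dom: "(\<lambda>p. norm (case p of (m, r) \<Rightarrow> q ^ m * a ^ r)) summable_on UNIV"
    by (rule has_sum_mult_Times(1)) (intro geo q a)+
  have abs: "(\<lambda>p. norm (?F p)) summable_on UNIV"
  proof (rule Infinite_Sum.abs_summable_on_comparison_test[OF dom])
    fix p :: "nat \<times> nat"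
    obtain m r where p: "p = (m, r)" by (cases p)
    have "norm (?F p) = norm a ^ Suc r * norm q ^ (m * Suc r) / real (Suc r)"
      by (simp add: p norm_divide norm_mult norm_power power_mult power_mult_distrib
          del: of_nat_Suc power_Suc mult_Suc_right)
    also have "\<dots> \<le> norm a ^ Suc r * norm q ^ (m * Suc r)"
      using divide_left_mono[of 1 "real (Suc r)" "norm a ^ Suc r * norm q ^ (m * Suc r)"]
      by (simp del: power_Suc mult_Suc_right of_nat_Suc)
    also have "\<dots> \<le> norm a ^ r * norm q ^ m"
      using a q by (intro mult_mono power_decreasing) auto
    finally show "norm (?F p) \<le> norm (case p of (m, r) \<Rightarrow> q ^ m * a ^ r)"
      by (simp add: p norm_mult norm_power mult.commute)
  qed
  then obtain S where S: "(?F has_sum S) (Sigma UNIV (\<lambda>_. UNIV))"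
    using abs_summable_summable unfolding summable_on_def by auto
  have inner: "((\<lambda>r. ?F (m, r)) has_sum log_one_minus (a * q ^ m)) UNIV" for m
  proof -
    have "(\<lambda>r. ?F (m, r)) summable_on UNIV"
      using summable_on_SigmaD1[of "\<lambda>m r. ?F (m, r)" UNIV "\<lambda>_. UNIV" m] abs_summable_summable[OF abs] by simp
    then have "((\<lambda>r. - ?F (m, r)) has_sum - infsum (\<lambda>r. ?F (m, r)) UNIV) UNIV"
      by (intro has_sum_uminusI has_sum_infsum)
    from has_sum_imp_sums[OF this] have "infsum (\<lambda>r. ?F (m, r)) UNIV = log_one_minus (a * q ^ m)"
      by (simp add: sums_iff log_one_minus_def)
    with has_sum_infsum[OF \<open>(\<lambda>r. ?F (m, r)) summable_on UNIV\<close>] show ?thesis by simp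
  qed
  have "((\<lambda>m. log_one_minus (a * q ^ m)) has_sum S) UNIV"
    by (rule has_sum_SigmaD[OF S]) (use inner in auto)
  then have "S = log_qpochhammer_inf a q"
    by (simp add: has_sum_imp_sums log_qpochhammer_inf_def sums_unique)
  with S show ?thesis by simp
qed

section \<open>Mellin transforms of exponential series\<close>

text \<open>
  Euler's integral for \<open>\<Gamma>\<close> after the substitution \<open>t \<mapsto> c * t\<close>, moved from the gauge integral to the
  Lebesgue integral.
\<close>
lemma has_bochner_integral_exp_powr:
  fixes c :: real
  assumes s: "Re s > 0" and c: "c > 0"
  shows "has_bochner_integral lborel
           (\<lambda>t. indicator {0<..} t *\<^sub>R (of_real (exp (- c * t)) * complex_of_real t powr (s - 1)))
           (Gamma s / of_real c powr s)"
proof -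
  let ?g = "\<lambda>t. complex_of_real t powr (s - 1) / of_real (exp t)"
  have meas: "(\<lambda>t. indicator {0<..} t *\<^sub>R ?g t) \<in> borel_measurable borel"
    by (intro borel_measurable_continuous_on_indicator continuous_intros)
       (auto simp: complex_nonpos_Reals_iff)
  have "set_integrable lebesgue {0<..} ?g"
    using absolutely_integrable_Gamma_integral'[OF s] .
  then have int: "set_integrable lborel {0<..} ?g"
    unfolding set_integrable_def using meas by (simp add: integrable_completion)
  have "(LINT t:{0<..}|lborel. ?g t) = Gamma s"
    using set_borel_integral_eq_integral(2)[OF int] Gamma_integral_complex'[OF s]
    by (simp add: integral_unique)
  with int have "has_bochner_integral lborel (\<lambda>t. indicator {0<..} t *\<^sub>R ?g t) (Gamma s)"
    by (simp add: has_bochner_integral_iff set_integrable_def set_lebesgue_integral_def)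
  then have "has_bochner_integral lborel
      (\<lambda>t. indicator {0<..} (0 + c * t) *\<^sub>R ?g (0 + c * t)) (Gamma s /\<^sub>R \<bar>c\<bar>)"
    using c by (subst (asm) lborel_has_bochner_integral_real_affine_iff[where c = c and t = 0]) auto
  from has_bochner_integral_mult_left[OF this, of "of_real c powr (1 - s)"]
  have *: "has_bochner_integral lborel
    (\<lambda>t. (indicator {0<..} (0 + c * t) *\<^sub>R ?g (0 + c * t)) * of_real c powr (1 - s))
    ((Gamma s /\<^sub>R \<bar>c\<bar>) * of_real c powr (1 - s))" by simp
  have 1: "(Gamma s /\<^sub>R \<bar>c\<bar>) * of_real c powr (1 - s) = Gamma s / of_real c powr s"
    using c by (simp add: powr_diff scaleR_conv_of_real field_simps)
  have 2: "(indicator {0<..} (0 + c * t) *\<^sub>R ?g (0 + c * t)) * of_real c powr (1 - s) =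
     indicator {0<..} t *\<^sub>R (of_real (exp (- c * t)) * complex_of_real t powr (s - 1))" for t
  proof (cases "t > 0")
    case True
    have "complex_of_real c powr (s - 1) * complex_of_real c powr (1 - s) = 1"
      using c by (simp flip: powr_add)
    moreover have "complex_of_real (c * t) powr (s - 1) =
        complex_of_real c powr (s - 1) * complex_of_real t powr (s - 1)"
      using c True by (simp add: powr_times_real)
    ultimately show ?thesis using True c
      by (simp add: indicator_def exp_minus field_simps)
  qed (use c in \<open>simp add: indicator_def zero_less_mult_iff\<close>)
  show ?thesis using * unfolding 1 2 .
qed

text \<open>
  The Mellin transform turns a series of exponentials into a generalised Dirichlet series.
  Integrating term by term is legitimate because the integral of the norm of the \<open>n\<close>-th term is
  \<open>\<Gamma>(Re s) * norm (b n) / c n powr Re s\<close>: these integrals are summable precisely by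
  the absolute convergence of the Dirichlet series.
\<close>
lemma mellin_transform_exp_series:
  fixes b :: "nat \<Rightarrow> complex" and c :: "nat \<Rightarrow> real"
  assumes s: "Re s > 0" and c: "\<And>n. c n > 0"
    and F: "\<And>h. h > 0 \<Longrightarrow> ((\<lambda>n. b n * of_real (exp (- c n * h))) has_sum F h) UNIV"
    and dirichlet: "summable (\<lambda>n. norm (b n) / c n powr Re s)"
  shows "set_integrable lborel {0<..} (\<lambda>h. F h * of_real h powr (s - 1))"
    and "(\<lambda>n. Gamma s * (b n / of_real (c n) powr s)) sums
           (LINT h:{0<..}|lborel. F h * of_real h powr (s - 1))"
proof -
  define f where "f n h = b n * (indicator {0<..} h *\<^sub>R
      (of_real (exp (- c n * h)) * complex_of_real h powr (s - 1)))" for n h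
  have f: "has_bochner_integral lborel (f n) (b n * (Gamma s / of_real (c n) powr s))" for n
    unfolding f_def by (intro has_bochner_integral_mult_right has_bochner_integral_exp_powr s c)
  have norm_f: "norm (f n h) = norm (b n) * norm (indicator {0<..} h *\<^sub>R
      (of_real (exp (- c n * h)) * complex_of_real h powr (of_real (Re s) - 1)))" for n h
    by (auto simp: f_def norm_mult indicator_def norm_powr_real_powr)
  have sum: "summable (\<lambda>n. norm (f n h))"
    and f_sum: "(\<Sum>n. f n h) = indicator {0<..} h *\<^sub>R (F h * of_real h powr (s - 1))" for h
  proof -
    have "((\<lambda>n. f n h) has_sum (indicator {0<..} h *\<^sub>R (F h * of_real h powr (s - 1)))) UNIV"
    proof (cases "h > 0")
      case True
      with has_sum_cmult_left[OF F[OF True], of "of_real h powr (s - 1)"] show ?thesis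
        by (simp add: f_def mult_ac)
    qed (simp add: f_def)
    then show "(\<Sum>n. f n h) = indicator {0<..} h *\<^sub>R (F h * of_real h powr (s - 1))"
        "summable (\<lambda>n. norm (f n h))"
      using has_sum_imp_sums sums_unique summable_on_iff_abs_summable_on_complex
        summable_on_imp_summable summable_on_def by (metis, metis)
  qed
  have "(\<integral>h. norm (f n h) \<partial>lborel) = Gamma (Re s) * (norm (b n) / c n powr Re s)" for n
  proof -
    let ?k = "\<lambda>h. indicator {0<..} h *\<^sub>R
      (of_real (exp (- c n * h)) * complex_of_real h powr (of_real (Re s) - 1))"
    have k: "has_bochner_integral lborel ?k (Gamma (of_real (Re s)) / of_real (c n) powr of_real (Re s))"
      using s c by (intro has_bochner_integral_exp_powr) auto
    \<comment> \<open>At the real exponent \<open>Re s\<close> the integrand is nonnegative, so its Gamma integral is the integral of the norm.\<close>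
    have eq: "?k = (\<lambda>h. of_real (norm (?k h)))"
      using powr_of_real[of _ "Re s - 1"] by (auto simp: fun_eq_iff indicator_def norm_mult)
    have "has_bochner_integral lborel (\<lambda>h. complex_of_real (norm (?k h)))
       (Gamma (of_real (Re s)) / of_real (c n) powr of_real (Re s))"
      by (subst eq[symmetric]) (rule k)
    moreover have "Gamma (of_real (Re s)) / complex_of_real (c n) powr of_real (Re s) =
      of_real (Gamma (Re s) / c n powr Re s)"
      using c[of n] by (simp add: powr_of_real Gamma_complex_of_real)
    ultimately have "has_bochner_integral lborel (\<lambda>h. norm (?k h)) (Gamma (Re s) / c n powr Re s)"
      using has_bochner_integral_bounded_linear[OF bounded_linear_Re] by fastforce
    then have "has_bochner_integral lborel (\<lambda>h. norm (b n) * norm (?k h))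
        (norm (b n) * (Gamma (Re s) / c n powr Re s))"
      by (rule has_bochner_integral_mult_right)
    then show ?thesis unfolding norm_f has_bochner_integral_iff by (simp add: mult_ac)
  qed
  then have int_sum: "summable (\<lambda>n. \<integral>h. norm (f n h) \<partial>lborel)"
    using summable_mult[OF dirichlet] by simp
  have int: "integrable lborel (f n)" for n using f by (simp add: has_bochner_integral_iff)
  have val: "integral\<^sup>L lborel (f n) = Gamma s * (b n / of_real (c n) powr s)" for n
    using f[of n] by (simp add: has_bochner_integral_iff)
  show "set_integrable lborel {0<..} (\<lambda>h. F h * of_real h powr (s - 1))"
    using integrable_suminf[OF int _ int_sum] sum by (simp add: set_integrable_def f_sum)
  show "(\<lambda>n. Gamma s * (b n / of_real (c n) powr s)) sums
           (LINT h:{0<..}|lborel. F h * of_real h powr (s - 1))"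
    using sums_integral[OF int _ int_sum] sum by (simp add: set_lebesgue_integral_def f_sum val)
qed

section \<open>Zeta over the odd numbers\<close>

lemma summable_norm_zeta_series:
  assumes s: "Re s > 1"
  shows "summable (\<lambda>n. norm (1 / of_nat (Suc n) powr s :: complex))"
proof -
  have "summable (\<lambda>n. norm (exp (of_real (ln (of_nat n)) * (- s))))"
    by (rule iffD2[OF abs_summable_complex_powr_iff]) (use s in simp)
  then have "summable (\<lambda>n. norm (exp (of_real (ln (of_nat (Suc n))) * (- s))))"
    by (subst summable_Suc_iff)
  moreover have "exp (of_real (ln (of_nat (Suc n))) * (- s)) = 1 / of_nat (Suc n) powr s" for n
    using Ln_of_real[of "real (Suc n)"]
    by (simp add: powr_def exp_minus inverse_eq_divide mult_ac del: of_nat_Suc)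
  ultimately show ?thesis by (simp only:)
qed

text \<open>
  Grouping the zeta series in consecutive pairs and subtracting the even-numbered terms, which
  together make up \<open>2 powr (- s)\<close> times the whole series, leaves the odd-numbered ones.
\<close>
lemma odd_zeta_series:
  assumes s: "Re s > 1"
  shows "summable (\<lambda>n. norm (1 / of_nat (2 * n + 1) powr s :: complex))"
    and "(\<lambda>n. 1 / of_nat (2 * n + 1) powr s) sums ((1 - 2 powr (- s)) * riemann_zeta s)"
proof -
  let ?f = "\<lambda>n. 1 / of_nat (Suc n) powr s :: complex"
  have norm_f: "summable (\<lambda>n. norm (?f n))" by (rule summable_norm_zeta_series[OF s])
  have f: "?f sums riemann_zeta s"
    unfolding riemann_zeta_def by (intro summable_sums summable_norm_cancel[OF norm_f])
  have pair: "(\<lambda>n. \<Sum>k\<in>{n*2..<n*2+2}. ?f k) sums riemann_zeta s"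
    by (rule sums_group[OF f]) simp
  have even: "?f (n*2 + 1) = 2 powr (-s) * ?f n" for n
    using powr_times_real[of 2 "of_nat (Suc n)" s]
    by (simp add: powr_minus field_simps)
  show "(\<lambda>n. 1 / of_nat (2 * n + 1) powr s) sums ((1 - 2 powr (- s)) * riemann_zeta s)"
    using sums_diff[OF pair sums_mult[OF f, of "2 powr (-s)"]] even
    by (simp add: numeral_2_eq_2 algebra_simps)
  have "summable (\<lambda>n. norm (?f (2 * n)))"
    using summable_reindex[OF norm_f, of "\<lambda>n. 2 * n"] by (simp add: o_def inj_on_def)
  then show "summable (\<lambda>n. norm (1 / of_nat (2 * n + 1) powr s :: complex))" by simp
qed

section \<open>The character packet\<close>

text \<open>
  Expanding the logarithms makes the \<open>k\<close>-th summand depend on \<open>k\<close> only through the phase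
  \<open>root_of_unity N ^ (k * Suc r)\<close>; summing over \<open>k\<close> first therefore produces a twisted Gauss sum,
  and separability makes the coefficient a multiple of \<open>inv_character chi\<close>.
\<close>
lemma packet_fun_expansion:
  assumes prim: "primitive_dirichlet_character N chi" and h: "h > 0"
  shows "((\<lambda>(m, r). - gauss_sum N chi * (inv_character chi (int (Suc r)) / of_nat (Suc r)) *
             of_real (exp (- (real (2 * m + 1) * real (Suc r)) * h))) has_sum packet_fun N chi h) UNIV"
proof -
  let ?w = "root_of_unity N"
  let ?q = "exp (- 2 * complex_of_real h)"
  have norm_w: "norm (?w ^ k) = 1" for k
    by (simp add: norm_power root_of_unity_def)
  have term_eq: "((exp (- of_real h) * ?w ^ k) * ?q ^ m) ^ Suc r =
      of_real (exp (- (real (2 * m + 1) * real (Suc r)) * h)) * ?w ^ (k * Suc r)" for k m r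
  proof -
    have "exp (- complex_of_real h) * ?q ^ m = exp (- complex_of_real h + of_nat m * (- 2 * of_real h))"
      by (simp only: exp_add exp_of_nat_mult)
    then have "(exp (- complex_of_real h) * ?q ^ m) ^ Suc r =
        exp (of_nat (Suc r) * (- complex_of_real h + of_nat m * (- 2 * of_real h)))"
      by (simp only: exp_of_nat_mult)
    also have "of_nat (Suc r) * (- complex_of_real h + of_nat m * (- 2 * of_real h)) =
        of_real (- (real (2 * m + 1) * real (Suc r)) * h)"
      by (simp add: algebra_simps)
    finally show ?thesis
      by (simp only: exp_of_real power_mult power_mult_distrib mult_ac)
  qed
  have "((\<lambda>(m, r). - (((exp (- of_real h) * ?w ^ k) * ?q ^ m) ^ Suc r / of_nat (Suc r))) has_sum
      log_qpochhammer_inf (exp (- of_real h) * ?w ^ k) ?q) UNIV" for k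
    using h by (intro has_sum_log_qpochhammer_inf) (auto simp: norm_mult norm_w)
  then have "((\<lambda>p. \<Sum>k\<in>totatives N. chi (int k) *
        (case p of (m, r) \<Rightarrow> - (((exp (- of_real h) * ?w ^ k) * ?q ^ m) ^ Suc r / of_nat (Suc r))))
      has_sum packet_fun N chi h) UNIV"
    unfolding packet_fun_def by (intro has_sum_finite_sum has_sum_cmult_right)
  moreover have "(\<Sum>k\<in>totatives N. chi (int k) *
        (case p of (m, r) \<Rightarrow> - (((exp (- of_real h) * ?w ^ k) * ?q ^ m) ^ Suc r / of_nat (Suc r)))) =
      (case p of (m, r) \<Rightarrow> - gauss_sum N chi * (inv_character chi (int (Suc r)) / of_nat (Suc r)) *
             of_real (exp (- (real (2 * m + 1) * real (Suc r)) * h)))" for p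
  proof -
    obtain m r where p: "p = (m, r)" by (cases p)
    define E where "E = complex_of_real (exp (- (real (2 * m + 1) * real (Suc r)) * h))"
    have "(\<Sum>k\<in>totatives N. chi (int k) * - (E * ?w ^ (k * Suc r) / of_nat (Suc r))) =
        - (E / of_nat (Suc r)) * (\<Sum>k\<in>totatives N. chi (int k) * ?w ^ (k * Suc r))"
      unfolding sum_distrib_left by (intro sum.cong refl) simp
    also have "\<dots> = - gauss_sum N chi * (inv_character chi (int (Suc r)) / of_nat (Suc r)) * E"
      by (simp only: gauss_sum_separable[OF prim]) simp
    finally show ?thesis by (simp only: p prod.case term_eq E_def)
  qed
  ultimately show ?thesis by simp
qed

theorem theorem5p13:
  fixes N :: nat and chi :: "int \<Rightarrow> complex" and s :: complex
  assumes "primitive_dirichlet_character N chi"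
    and "odd_character chi"
    and "Re s > 1"
  shows "set_integrable lborel {0<..} (packet_integrand N chi s) \<and>
         packet_L N chi s =
           - gauss_sum N chi * (1 - 2 powr (- s)) * riemann_zeta s *
             dirichlet_L (inv_character chi) (s + 1)"
proof -
  define G where "G = gauss_sum N chi"
  define b where "b = (\<lambda>(m::nat, r). - G * (inv_character chi (int (Suc r)) / of_nat (Suc r)))"
  define c where "c = (\<lambda>(m, r). real (2 * m + 1) * real (Suc r))"
  define Z where "Z = (\<lambda>m. 1 / complex_of_nat (2 * m + 1) powr s)"
  define X where "X = (\<lambda>r. inv_character chi (int (Suc r)) / complex_of_nat (Suc r) powr (s + 1))"
  have chi: "dirichlet_character N chi"
    using assms(1) by (simp add: primitive_dirichlet_character_def)
  have c_pos: "c p > 0" for p by (auto simp: c_def split: prod.split)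
  have Z: "summable (\<lambda>m. norm (Z m))" "suminf Z = (1 - 2 powr (- s)) * riemann_zeta s"
    using odd_zeta_series[OF assms(3)] by (simp_all add: Z_def sums_iff)
  have X: "summable (\<lambda>r. norm (X r))"
  proof -
    obtain B where B: "norm (inverse (chi a)) \<le> B" for a
      using dirichlet_character_inverse_bounded[OF chi] by blast
    have "summable (\<lambda>r. B * norm (1 / complex_of_nat (Suc r) powr (s + 1)))"
      using assms(3) by (intro summable_mult summable_norm_zeta_series) simp
    then show ?thesis
    proof (rule summable_comparison_test')
      fix r
      have "norm (X r) = norm (inverse (chi (int (Suc r)))) * norm (1 / complex_of_nat (Suc r) powr (s + 1))"
        by (simp only: X_def inv_character_def norm_divide norm_one) simp
      also have "\<dots> \<le> B * norm (1 / complex_of_nat (Suc r) powr (s + 1))"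
        by (intro mult_right_mono B norm_ge_zero)
      finally show "norm (norm (X r)) \<le> B * norm (1 / complex_of_nat (Suc r) powr (s + 1))" by simp
    qed
  qed
  \<comment> \<open>The factor \<open>1 / Suc r\<close> from the logarithm series is what shifts \<open>s\<close> to \<open>s + 1\<close> in the \<open>L\<close>-series.\<close>
  have coeff: "b p / of_real (c p) powr s = - G * (case p of (m, r) \<Rightarrow> Z m * X r)" for p
  proof -
    obtain m r where p: "p = (m, r)" by (cases p)
    have "of_real (c p) powr s = complex_of_nat (2 * m + 1) powr s * complex_of_nat (Suc r) powr s"
      using powr_times_real[of "of_nat (2 * m + 1)" "of_nat (Suc r)" s]
      by (simp add: c_def p del: of_nat_Suc of_nat_add of_nat_mult)
    moreover have "complex_of_nat (Suc r) powr (s + 1) = complex_of_nat (Suc r) powr s * of_nat (Suc r)"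
      by (simp add: powr_add del: of_nat_Suc)
    ultimately show ?thesis
      by (simp add: p b_def Z_def X_def del: of_nat_Suc)
  qed
  have bij: "bij_betw prod_decode UNIV UNIV" by (rule bij_prod_decode)
  have norm_eq: "norm (b p) / c p powr Re s = norm (b p / of_real (c p) powr s)" for p
    using c_pos[of p] by (simp add: norm_divide norm_powr_real_powr)
  have "(\<lambda>p. norm (- G) * norm (case p of (m, r) \<Rightarrow> Z m * X r)) summable_on UNIV"
    by (intro summable_on_cmult_right has_sum_mult_Times(1) Z X)
  then have "(\<lambda>p. norm (b p) / c p powr Re s) summable_on UNIV"
    by (simp add: norm_eq coeff norm_mult)
  then have "(\<lambda>n. norm (b (prod_decode n)) / c (prod_decode n) powr Re s) summable_on UNIV"
    by (subst summable_on_reindex_bij_betw[OF bij])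
  then have dirichlet: "summable (\<lambda>n. norm (b (prod_decode n)) / c (prod_decode n) powr Re s)"
    by (rule summable_on_imp_summable)
  have F: "((\<lambda>n. b (prod_decode n) * of_real (exp (- c (prod_decode n) * h)))
      has_sum packet_fun N chi h) UNIV"
    if "h > 0" for h
  proof -
    have "((\<lambda>p. b p * of_real (exp (- c p * h))) has_sum packet_fun N chi h) UNIV"
      using packet_fun_expansion[OF assms(1) that]
      by (simp add: b_def c_def G_def case_prod_unfold del: of_nat_Suc)
    then show ?thesis by (subst has_sum_reindex_bij_betw[OF bij])
  qed
  note mellin = mellin_transform_exp_series[where b = "\<lambda>n. b (prod_decode n)" and c = "\<lambda>n. c (prod_decode n)"
      and F = "packet_fun N chi" and s = s, OF _ c_pos F dirichlet]
  have "((\<lambda>p. b p / of_real (c p) powr s) has_sum (- G * (suminf Z * suminf X))) UNIV"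
    unfolding coeff by (intro has_sum_cmult_right has_sum_mult_Times(2) Z X)
  then have "((\<lambda>n. b (prod_decode n) / of_real (c (prod_decode n)) powr s) has_sum
      (- G * (suminf Z * suminf X))) UNIV"
    by (subst has_sum_reindex_bij_betw[OF bij])
  from sums_mult[OF has_sum_imp_sums[OF this], of "Gamma s"]
  have "(LINT h:{0<..}|lborel. packet_fun N chi h * of_real h powr (s - 1)) =
      Gamma s * (- G * (suminf Z * suminf X))"
    using mellin(2) assms(3) by (intro sums_unique2) auto
  moreover have "Gamma s \<noteq> 0"
    using assms(3) by (auto simp: Gamma_eq_zero_iff elim!: nonpos_Ints_cases)
  moreover have "suminf X = dirichlet_L (inv_character chi) (s + 1)"
    by (simp add: X_def dirichlet_L_def)
  ultimately have "packet_L N chi s =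
           - gauss_sum N chi * (1 - 2 powr (- s)) * riemann_zeta s *
             dirichlet_L (inv_character chi) (s + 1)"
    by (simp add: packet_L_def packet_integrand_def Z(2) G_def)
  moreover have "set_integrable lborel {0<..} (packet_integrand N chi s)"
    using mellin(1) assms(3) by (simp add: packet_integrand_def[abs_def])
  ultimately show ?thesis by blast
qed

end
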